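(* Let $R$ be a Reynolds operator on a $3$-Lie algebra $(\mathfrak g,[\cdot,\cdot,\cdot]_{\mathfrak g})$. Then $R$ is a $\Phi$-twisted Rota-Baxter operator on $\mathfrak g$ with respect to the adjoint representation $(\mathfrak g;\mathrm{ad})$, where $\Phi\in\mathrm{Hom}(\wedge^3\mathfrak g,\mathfrak g)$ is defined by $$\Phi(x,y,z)=-[x,y,z]_{\mathfrak g},\qquad x,y,z\in\mathfrak g.$$
   Context: All vector spaces are over a fixed field. A 3-Lie algebra is a vector space $\mathfrak g$ with a skew-symmetric trilinear map $[\cdot,\cdot,\cdot]_{\mathfrak g}$ (i.e. a linear map $\wedge^3\mathfrak g\to\mathfrak g$) such that for all $x_1,\dots,x_5\in\mathfrak g$: $[x_1,x_2,[x_3,x_4,x_5]_{\mathfrak g}]_{\mathfrak g}=[[x_1,x_2,x_3]_{\mathfrak g},x_4,x_5]_{\mathfrak g}+[x_3,[x_1,x_2,x_4]_{\mathfrak g},x_5]_{\mathfrak g}+[x_3,x_4,[x_1,x_2,x_5]_{\mathfrak g}]_{\mathfrak g}$. A representation of $\mathfrak g$ is a pair $(V;\rho)$ with $V$ a vector space and $\rho:\wedge^2\mathfrak g\to\mathfrak{gl}(V)$ linear such that for all $x_1,\dots,x_4\in\mathfrak g$: (i) $[\rho(x_1,x_2),\rho(x_3,x_4)]=\rho([x_1,x_2,x_3]_{\mathfrak g},x_4)+\rho(x_3,[x_1,x_2,x_4]_{\mathfrak g})$ (commutator on the left); (ii) $\rho([x_1,x_2,x_3]_{\mathfrak g},x_4)=\rho(x_1,x_2)\rho(x_3,x_4)+\rho(x_2,x_3)\rho(x_1,x_4)+\rho(x_3,x_1)\rho(x_2,x_4)$.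 The adjoint representation is $(\mathfrak g;\mathrm{ad})$ with $\mathrm{ad}(x_1,x_2)x_3=[x_1,x_2,x_3]_{\mathfrak g}$. A 2-cocycle on $\mathfrak g$ with coefficients in $(V;\rho)$ is a linear map $\Phi:\wedge^3\mathfrak g\to V$ such that for all $x_1,\dots,x_5\in\mathfrak g$: $\Phi(x_1,x_2,[x_3,x_4,x_5]_{\mathfrak g})-\Phi([x_1,x_2,x_3]_{\mathfrak g},x_4,x_5)-\Phi(x_3,[x_1,x_2,x_4]_{\mathfrak g},x_5)-\Phi(x_3,x_4,[x_1,x_2,x_5]_{\mathfrak g})+\rho(x_1,x_2)\Phi(x_3,x_4,x_5)-\rho(x_3,x_4)\Phi(x_1,x_2,x_5)-\rho(x_4,x_5)\Phi(x_1,x_2,x_3)-\rho(x_5,x_3)\Phi(x_1,x_2,x_4)=0$. For a 2-cocycle $\Phi$ (being a 2-cocycle is part of the notion), a $\Phi$-twisted Rota-Baxter operator on $\mathfrak g$ with respect to $(V;\rho)$ is a linear map $T:V\to\mathfrak g$ with $[Tu,Tv,Tw]_{\mathfrak g}=T\big(\rho(Tu,Tv)w+\rho(Tv,Tw)u+\rho(Tw,Tu)v+\Phi(Tu,Tv,Tw)\big)$ for all $u,v,w\in V$. A Reynolds operator on $\mathfrak g$ is a linear map $R:\mathfrak g\to\mathfrak g$ with $[Rx,Ry,Rz]_{\mathfrak g}=R\big([Rx,Ry,z]_{\mathfrak g}+[x,Ry,Rz]_{\mathfrak g}+[Rx,y,Rz]_{\mathfrak g}-[Rx,Ry,Rz]_{\mathfrak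 g}\big)$ for all $x,y,z\in\mathfrak g$. *)

theory Defs
  imports Complex_Main
begin

text \<open>
  A linear map out of an exterior power is encoded as a multilinear map which vanishes as soon as
  two of its arguments coincide; in characteristic 2 this is stronger than changing sign under
  transpositions.  A vector space is a type together with its scalar multiplication, as in
  \<^locale>\<open>vector_space\<close>.
\<close>

locale alternating_trilinear =
  dom: vector_space s1 + cod: vector_space s2
  for s1 :: "'k::field \<Rightarrow> 'a::ab_group_add \<Rightarrow> 'a"
    and s2 :: "'k \<Rightarrow> 'b::ab_group_add \<Rightarrow> 'b" +
  fixes F :: "'a \<Rightarrow> 'a \<Rightarrow> 'a \<Rightarrow> 'b"
  assumes linear_1: "Vector_Spaces.linear s1 s2 (\<lambda>x. F x y z)"
    and linear_2: "Vector_Spaces.linear s1 s2 (\<lambda>y. F x y z)"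
    and linear_3: "Vector_Spaces.linear s1 s2 (\<lambda>z. F x y z)"
    and alternating_12: "F x x z = 0"
    and alternating_23: "F x y y = 0"
    and alternating_13: "F x y x = 0"

locale three_Lie_algebra =
  alternating_trilinear s s br
  for s :: "'k::field \<Rightarrow> 'g::ab_group_add \<Rightarrow> 'g"
    and br :: "'g \<Rightarrow> 'g \<Rightarrow> 'g \<Rightarrow> 'g" +
  assumes fundamental_identity:
    "br x1 x2 (br x3 x4 x5) =
       br (br x1 x2 x3) x4 x5 + br x3 (br x1 x2 x4) x5 + br x3 x4 (br x1 x2 x5)"

text \<open>
  The map \<open>\<rho>\<close> takes values in the linear endomorphisms of \<open>V\<close>, whose vector space structure is
  pointwise; hence bilinearity and the identities between endomorphisms are stated at each \<open>v\<close>.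
\<close>

locale three_Lie_representation =
  three_Lie_algebra s br + rep: vector_space sV
  for s :: "'k::field \<Rightarrow> 'g::ab_group_add \<Rightarrow> 'g"
    and br :: "'g \<Rightarrow> 'g \<Rightarrow> 'g \<Rightarrow> 'g"
    and sV :: "'k \<Rightarrow> 'v::ab_group_add \<Rightarrow> 'v" +
  fixes \<rho> :: "'g \<Rightarrow> 'g \<Rightarrow> 'v \<Rightarrow> 'v"
  assumes rho_endomorphism: "Vector_Spaces.linear sV sV (\<rho> x y)"
    and rho_linear_1: "Vector_Spaces.linear s sV (\<lambda>x. \<rho> x y v)"
    and rho_linear_2: "Vector_Spaces.linear s sV (\<lambda>y. \<rho> x y v)"
    and rho_alternating: "\<rho> x x v = 0"
    and rho_commutator:
      "\<rho> x1 x2 (\<rho> x3 x4 v) - \<rho> x3 x4 (\<rho> x1 x2 v) =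
         \<rho> (br x1 x2 x3) x4 v + \<rho> x3 (br x1 x2 x4) v"
    and rho_bracket:
      "\<rho> (br x1 x2 x3) x4 v =
         \<rho> x1 x2 (\<rho> x3 x4 v) + \<rho> x2 x3 (\<rho> x1 x4 v) + \<rho> x3 x1 (\<rho> x2 x4 v)"

definition ad :: "('g \<Rightarrow> 'g \<Rightarrow> 'g \<Rightarrow> 'g) \<Rightarrow> 'g \<Rightarrow> 'g \<Rightarrow> 'g \<Rightarrow> 'g" where
  "ad br x1 x2 = (\<lambda>x3. br x1 x2 x3)"

locale two_cocycle =
  three_Lie_representation s br sV \<rho> + cochain: alternating_trilinear s sV \<Phi>
  for s :: "'k::field \<Rightarrow> 'g::ab_group_add \<Rightarrow> 'g"
    and br :: "'g \<Rightarrow> 'g \<Rightarrow> 'g \<Rightarrow> 'g"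
    and sV :: "'k \<Rightarrow> 'v::ab_group_add \<Rightarrow> 'v"
    and \<rho> :: "'g \<Rightarrow> 'g \<Rightarrow> 'v \<Rightarrow> 'v"
    and \<Phi> :: "'g \<Rightarrow> 'g \<Rightarrow> 'g \<Rightarrow> 'v" +
  assumes cocycle:
    "\<Phi> x1 x2 (br x3 x4 x5) - \<Phi> (br x1 x2 x3) x4 x5
       - \<Phi> x3 (br x1 x2 x4) x5 - \<Phi> x3 x4 (br x1 x2 x5)
       + \<rho> x1 x2 (\<Phi> x3 x4 x5) - \<rho> x3 x4 (\<Phi> x1 x2 x5)
       - \<rho> x4 x5 (\<Phi> x1 x2 x3) - \<rho> x5 x3 (\<Phi> x1 x2 x4) = 0"

locale twisted_Rota_Baxter_operator =
  two_cocycle s br sV \<rho> \<Phi>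
  for s :: "'k::field \<Rightarrow> 'g::ab_group_add \<Rightarrow> 'g"
    and br :: "'g \<Rightarrow> 'g \<Rightarrow> 'g \<Rightarrow> 'g"
    and sV :: "'k \<Rightarrow> 'v::ab_group_add \<Rightarrow> 'v"
    and \<rho> :: "'g \<Rightarrow> 'g \<Rightarrow> 'v \<Rightarrow> 'v"
    and \<Phi> :: "'g \<Rightarrow> 'g \<Rightarrow> 'g \<Rightarrow> 'v" +
  fixes T :: "'v \<Rightarrow> 'g"
  assumes operator_linear: "Vector_Spaces.linear sV s T"
    and twisted_Rota_Baxter:
      "br (T u) (T v) (T w) =
         T (\<rho> (T u) (T v) w + \<rho> (T v) (T w) u + \<rho> (T w) (T u) v + \<Phi> (T u) (T v) (T w))"

locale Reynolds_operator =
  three_Lie_algebra s br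
  for s :: "'k::field \<Rightarrow> 'g::ab_group_add \<Rightarrow> 'g"
    and br :: "'g \<Rightarrow> 'g \<Rightarrow> 'g \<Rightarrow> 'g" +
  fixes R :: "'g \<Rightarrow> 'g"
  assumes operator_linear: "Vector_Spaces.linear s s R"
    and Reynolds:
      "br (R x) (R y) (R z) =
         R (br (R x) (R y) z + br x (R y) (R z) + br (R x) y (R z) - br (R x) (R y) (R z))"

end

theory Submission
  imports Defs
begin

text \<open>An alternating trilinear map is invariant under rotation of its arguments
  (\<open>cyclic\<close>). Rotating two terms turns the twisted Rota-Baxter identity for \<Phi> =
  -[.,.,.] into the Reynolds identity itself. There remain the representation axioms for
  \<open>ad br\<close> and the cocycle condition; both come from the fundamental identity, which
  says that each \<open>ad br x y\<close> is a derivation of the bracket.\<close>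

context alternating_trilinear
begin

lemmas add =
  module_hom.add[OF module_hom_linearI, OF linear_1]
  module_hom.add[OF module_hom_linearI, OF linear_2]
  module_hom.add[OF module_hom_linearI, OF linear_3]

lemmas scale =
  module_hom.scale[OF module_hom_linearI, OF linear_1]
  module_hom.scale[OF module_hom_linearI, OF linear_2]
  module_hom.scale[OF module_hom_linearI, OF linear_3]

text \<open>Polarisation: in the expansion at x + y the diagonal terms vanish, so the two mixed ones
  cancel.\<close>

lemma skew_12: "F y x z = - F x y z"
proof -
  have "0 = F (x + y) (x + y) z"
    by (simp add: alternating_12)
  also have "\<dots> = F x x z + F x y z + (F y x z + F y y z)"
    by (simp only: add ac_simps)
  finally show ?thesis
    by (simp add: alternating_12 eq_neg_iff_add_eq_0 add.commute)
qed

lemma skew_23: "F x z y = - F x y z"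
proof -
  have "0 = F x (y + z) (y + z)"
    by (simp add: alternating_23)
  also have "\<dots> = F x y y + F x y z + (F x z y + F x z z)"
    by (simp only: add ac_simps)
  finally show ?thesis
    by (simp add: alternating_23 eq_neg_iff_add_eq_0 add.commute)
qed

text \<open>A 3-cycle is a product of two transpositions, whose signs cancel.\<close>

lemma cyclic: "F y z x = F x y z"
  by (simp add: skew_23[of y z x] skew_12[of y x z])

lemma alternating_trilinear_uminus: "alternating_trilinear s1 s2 (\<lambda>x y z. - F x y z)"
  by unfold_locales
    (simp_all add: add scale cod.scale_minus_right alternating_12 alternating_23 alternating_13)

end

context three_Lie_algebra
begin

lemma three_Lie_representation_ad: "three_Lie_representation s br s (ad br)"
proof (unfold_locales, unfold ad_def)
  fix x1 x2 x3 x4 v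
  \<comment> \<open>The derivation \<open>ad br x1 x2\<close> applied to \<open>br x3 x4 v\<close>,
    with one term moved to the left.\<close>
  show "br x1 x2 (br x3 x4 v) - br x3 x4 (br x1 x2 v) =
      br (br x1 x2 x3) x4 v + br x3 (br x1 x2 x4) v"
    by (simp add: fundamental_identity[of x1 x2 x3 x4 v])
  \<comment> \<open>This is the fundamental identity for the derivation \<open>ad x4 v\<close> applied to \<open>br x1 x2 x3\<close>,
    up to cyclic permutations.\<close>
  have "br (br x1 x2 x3) x4 v = br x4 v (br x1 x2 x3)"
    by (rule cyclic[symmetric])
  also have "\<dots> = br (br x4 v x1) x2 x3 + br x1 (br x4 v x2) x3 + br x1 x2 (br x4 v x3)"
    by (rule fundamental_identity)
  also have "\<dots> = br x1 x2 (br x3 x4 v) + br x2 x3 (br x1 x4 v) + br x3 x1 (br x2 x4 v)"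
    by (simp add: cyclic[of x4 v] cyclic[of x2 x3 "br x1 x4 v"] cyclic[of x1 "br x2 x4 v" x3]
        add_ac)
  finally show "br (br x1 x2 x3) x4 v =
      br x1 x2 (br x3 x4 v) + br x2 x3 (br x1 x4 v) + br x3 x1 (br x2 x4 v)" .
qed (simp_all add: add scale alternating_12)

lemma two_cocycle_uminus_bracket: "two_cocycle s br s (ad br) (\<lambda>x y z. - br x y z)"
proof -
  interpret rep: three_Lie_representation s br s "ad br"
    by (rule three_Lie_representation_ad)
  interpret cochain: alternating_trilinear s s "\<lambda>x y z. - br x y z"
    by (rule alternating_trilinear_uminus)
  have neg: "br x y (- z) = - br x y z" for x y z
    by (rule module_hom.neg[OF module_hom_linearI, OF linear_3])
  show ?thesis
  proof (unfold_locales, unfold ad_def)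
    fix x1 x2 x3 x4 x5
    \<comment> \<open>The four \<Phi> terms and the four \<rho> terms vanish separately: each group
      is, up to rotation, the fundamental identity with all terms on one side.\<close>
    show "- br x1 x2 (br x3 x4 x5) - - br (br x1 x2 x3) x4 x5
        - - br x3 (br x1 x2 x4) x5 - - br x3 x4 (br x1 x2 x5)
        + br x1 x2 (- br x3 x4 x5) - br x3 x4 (- br x1 x2 x5)
        - br x4 x5 (- br x1 x2 x3) - br x5 x3 (- br x1 x2 x4) = 0"
      by (simp add: neg fundamental_identity[of x1 x2 x3 x4 x5]
          cyclic[of x4 x5 "br x1 x2 x3"] cyclic[of x3 "br x1 x2 x4" x5])
  qed
qed

end

theorem proposition4p8:
  fixes s :: "'k::field \<Rightarrow> 'g::ab_group_add \<Rightarrow> 'g"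
    and br :: "'g \<Rightarrow> 'g \<Rightarrow> 'g \<Rightarrow> 'g"
    and R :: "'g \<Rightarrow> 'g"
  assumes "three_Lie_algebra s br"
    and "Reynolds_operator s br R"
  shows "twisted_Rota_Baxter_operator s br s (ad br) (\<lambda>x y z. - br x y z) R"
proof -
  interpret Reynolds_operator s br R
    by (rule assms(2))
  interpret cocycle: two_cocycle s br s "ad br" "\<lambda>x y z. - br x y z"
    by (rule two_cocycle_uminus_bracket)
  show ?thesis
  proof (unfold_locales, unfold ad_def)
    fix u v w
    \<comment> \<open>Rotation moves the argument free of \<open>R\<close> back to the slot it has
      in the Reynolds identity.\<close>
    show "br (R u) (R v) (R w) =
        R (br (R u) (R v) w + br (R v) (R w) u + br (R w) (R u) v + - br (R u) (R v) (R w))"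
      using Reynolds[of u v w] by (simp add: cyclic[of "R v" "R w" u] cyclic[of "R u" v "R w"])
  \<comment> \<open>The goals left over are additivity and homogeneity of \<open>R\<close>, into
    which \<open>unfold_locales\<close> splits its linearity.\<close>
  qed (rule module_hom.add module_hom.scale, rule module_hom_linearI, rule operator_linear)+
qed

end
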